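(* Let $d\ge 2$ be an integer and let $\ell$ be a number. As operators acting on the space $V_\ell$ of even smooth functions on $\mathbb{R}^d\setminus\{0\}$ that are homogeneous of degree $\ell$, one has $$ \sum_{i\ne j} N_{ij}^2 = \Delta_K + (d-1)\,\ell + \frac{d-1}{d}\,\ell^2 - \frac{1}{d}\sum_{i<j} A_{ij}^2 ,\qquad \Delta_K := \sum_{i<j} K_{ij}^2 , $$ where all indices run over $\{1,\dots,d\}$.
   Context: $V_\ell$ is the space of smooth functions $v$ on $\mathbb{R}^d\setminus\{0\}$ such that $v(rx)=|r|^\ell v(x)$ for every non-zero real $r$ and every $x$. The group $\mathrm{SL}(d,\mathbb{R})$ acts on $V_\ell$ by $[T_\ell(g)v](x)=v(xg)$ ($x$ a row vector). The following infinitesimal generators act on $V_\ell$ as first-order differential operators: $$ K_{ij}=x_i\frac{\partial}{\partial x_j}-x_j\frac{\partial}{\partial x_i}\ (i<j),\qquad A_{ij}=x_i\frac{\partial}{\partial x_i}-x_j\frac{\partial}{\partial x_j}\ (i<j),\qquad N_{ij}=x_i\frac{\partial}{\partial x_j}\ (i\neq j). $$ Squares denote composition of an operator with itself; numbers such as $(d-1)\ell$ denote multiplication operators. *)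

theory Defs
  imports "HOL-Analysis.Analysis"
begin

primrec ck_on :: "nat \<Rightarrow> 'a::real_normed_vector set \<Rightarrow> ('a \<Rightarrow> 'b::real_normed_vector) \<Rightarrow> bool" where
  "ck_on 0 S f \<longleftrightarrow> continuous_on S f"
| "ck_on (Suc k) S f \<longleftrightarrow>
     (\<forall>x\<in>S. f differentiable (at x)) \<and>
     (\<forall>h. ck_on k S (\<lambda>x. frechet_derivative f (at x) h))"

text \<open>Meant for open sets \<open>S\<close> only, since derivatives are taken at \<open>x\<close> and not within \<open>S\<close>.\<close>
definition smooth_on :: "'a::real_normed_vector set \<Rightarrow> ('a \<Rightarrow> 'b::real_normed_vector) \<Rightarrow> bool" where
  "smooth_on S f \<longleftrightarrow> (\<forall>k. ck_on k S f)"

text \<open>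
  A function on \<open>\<real>\<^sup>d - {0}\<close> is represented by a total function whose value at \<open>0\<close> is irrelevant.
  Taking \<open>r = -1\<close> in the homogeneity condition shows that the elements of \<open>V l\<close> are even.
\<close>
definition V :: "complex \<Rightarrow> (real ^ 'n \<Rightarrow> complex) set" where
  "V l = {v. smooth_on (- {0}) v \<and>
             (\<forall>r x. r \<noteq> 0 \<longrightarrow> x \<noteq> 0 \<longrightarrow> v (r *\<^sub>R x) = complex_of_real \<bar>r\<bar> powr l * v x)}"

definition pderivative :: "'n \<Rightarrow> (real ^ 'n \<Rightarrow> complex) \<Rightarrow> real ^ 'n \<Rightarrow> complex" where
  "pderivative j v x = frechet_derivative v (at x) (axis j 1)"

definition N_op :: "'n \<Rightarrow> 'n \<Rightarrow> (real ^ 'n \<Rightarrow> complex) \<Rightarrow> real ^ 'n \<Rightarrow> complex" where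
  "N_op i j v x = x $ i *\<^sub>R pderivative j v x"

definition K_op :: "'n \<Rightarrow> 'n \<Rightarrow> (real ^ 'n \<Rightarrow> complex) \<Rightarrow> real ^ 'n \<Rightarrow> complex" where
  "K_op i j v x = x $ i *\<^sub>R pderivative j v x - x $ j *\<^sub>R pderivative i v x"

definition A_op :: "'n \<Rightarrow> 'n \<Rightarrow> (real ^ 'n \<Rightarrow> complex) \<Rightarrow> real ^ 'n \<Rightarrow> complex" where
  "A_op i j v x = x $ i *\<^sub>R pderivative i v x - x $ j *\<^sub>R pderivative j v x"

definition Delta_K :: "(real ^ 'n::{finite,linorder} \<Rightarrow> complex) \<Rightarrow> real ^ 'n::{finite,linorder} \<Rightarrow> complex" where
  "Delta_K v x = (\<Sum>(i, j)\<in>{(i, j). i < j}. (K_op i j ^^ 2) v x)"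

end

theory Submission
  imports Defs
begin

text \<open>
  With \<open>e\<^sub>i = x\<^sub>i \<partial>\<^sub>i\<close> and \<open>E = \<Sum> e\<^sub>i\<close>, the squares expand so that, after summation, the difference
  \<open>\<Sum> N\<^sub>i\<^sub>j\<^sup>2 - \<Delta>\<^sub>K\<close> is \<open>(d - 1) E + M\<close> with \<open>M = \<Sum>\<^bsub>i \<noteq> j\<^esub> x\<^sub>i x\<^sub>j \<partial>\<^sub>i \<partial>\<^sub>j\<close>, while
  \<open>\<Sum> A\<^sub>i\<^sub>j\<^sup>2 = d \<Sum> e\<^sub>i\<^sup>2 - E\<^sup>2\<close> and \<open>M = E\<^sup>2 - \<Sum> e\<^sub>i\<^sup>2\<close>; Euler's identity \<open>E v = l v\<close> finishes.
  The mixed derivatives enter \<open>K\<^sub>i\<^sub>j\<^sup>2\<close> and \<open>A\<^sub>i\<^sub>j\<^sup>2\<close> only through \<open>\<partial>\<^sub>i \<partial>\<^sub>j + \<partial>\<^sub>j \<partial>\<^sub>i\<close>, so their symmetry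
  is never needed.
\<close>

lemma smooth_on_differentiable:
  assumes "smooth_on S f" "x \<in> S"
  shows "f differentiable (at x)"
  using assms ck_on.simps(2)[of 0 S f] unfolding smooth_on_def by blast

lemma smooth_on_frechet_derivative:
  assumes "smooth_on S f"
  shows "smooth_on S (\<lambda>x. frechet_derivative f (at x) h)"
  using assms ck_on.simps(2) unfolding smooth_on_def by blast

lemma smooth_on_pderivative:
  assumes "smooth_on S v"
  shows "smooth_on S (pderivative j v)"
  using smooth_on_frechet_derivative[OF assms] by (simp add: pderivative_def[abs_def])

lemma pderivativeI:
  "(f has_derivative f') (at x) \<Longrightarrow> pderivative j f x = f' (axis j 1)"
  by (simp add: pderivative_def frechet_derivative_at[symmetric])

lemma pderivative_diff:
  assumes "f differentiable (at x)" "g differentiable (at x)"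
  shows "pderivative k (\<lambda>y. f y - g y) x = pderivative k f x - pderivative k g x"
  using pderivativeI[OF has_derivative_diff[OF assms[unfolded frechet_derivative_works]]]
  by (simp add: pderivative_def)

lemma pderivative_sum:
  assumes "\<And>i. i \<in> I \<Longrightarrow> f i differentiable (at x)"
  shows "pderivative k (\<lambda>y. \<Sum>i\<in>I. f i y) x = (\<Sum>i\<in>I. pderivative k (f i) x)"
  using pderivativeI[OF has_derivative_sum[of I f], OF assms[unfolded frechet_derivative_works]]
  by (simp add: pderivative_def)

lemma has_derivative_component_scaleR:
  fixes f :: "real ^ 'n \<Rightarrow> complex"
  assumes "f differentiable (at x)"
  shows "((\<lambda>y. y $ i *\<^sub>R f y) has_derivative
           (\<lambda>h. x $ i *\<^sub>R frechet_derivative f (at x) h + h $ i *\<^sub>R f x)) (at x)"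
  using assms[unfolded frechet_derivative_works]
  by (auto intro!: derivative_eq_intros bounded_linear_imp_has_derivative bounded_linear_vec_nth)

lemma differentiable_component_scaleR:
  fixes f :: "real ^ 'n \<Rightarrow> complex"
  assumes "f differentiable (at x)"
  shows "(\<lambda>y. y $ i *\<^sub>R f y) differentiable (at x)"
  using has_derivative_component_scaleR[OF assms] unfolding differentiable_def by blast

lemma pderivative_component_scaleR:
  assumes "f differentiable (at x)"
  shows "pderivative k (\<lambda>y. y $ i *\<^sub>R f y) x = x $ i *\<^sub>R pderivative k f x + (if i = k then f x else 0)"
  using pderivativeI[OF has_derivative_component_scaleR[OF assms]]
  by (auto simp: pderivative_def axis_def)

text \<open>Euler's identity is available only away from the origin. This locality principle is what
  allows it to be differentiated there.\<close>

lemma pderivative_cong_open: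
  assumes "open S" "x \<in> S" "\<And>y. y \<in> S \<Longrightarrow> f y = g y" "f differentiable (at x)"
  shows "pderivative k f x = pderivative k g x"
  using pderivativeI[OF has_derivative_transform_within_open[OF assms(4)[unfolded frechet_derivative_works] assms(1-3)]]
  by (simp add: pderivative_def)

lemma pderivative_cmult:
  assumes "f differentiable (at x)"
  shows "pderivative k (\<lambda>y. c * f y) x = c * pderivative k f x"
  using pderivativeI[OF has_derivative_mult_right[OF assms[unfolded frechet_derivative_works]]]
  by (simp add: pderivative_def)

text \<open>For distinct indices x_i commutes with the j-th partial derivative, so no first-order
  term arises.\<close>

lemma N_op_squared:
  assumes "pderivative j v differentiable (at x)" "i \<noteq> j"
  shows "(N_op i j ^^ 2) v x = of_real (x $ i) ^ 2 * pderivative j (pderivative j v) x"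
  using assms
  by (simp add: numeral_2_eq_2 N_op_def[abs_def] pderivative_component_scaleR)
    (simp add: scaleR_conv_of_real)

text \<open>The first-order terms come from the product rule in the two cross products. The
  expansion is grouped as g i j + g j i, with the second bracket the first one with \<open>i\<close>
  and \<open>j\<close> exchanged, which is the shape that \<open>sum_less_symmetrized\<close>
  consumes. \<open>A_op_squared\<close> is grouped in the same way.\<close>

lemma K_op_squared:
  assumes "\<And>k. pderivative k v differentiable (at x)" "i \<noteq> j"
  shows "(K_op i j ^^ 2) v x =
    (of_real (x $ i) ^ 2 * pderivative j (pderivative j v) x - of_real (x $ i) * pderivative i v x
      - of_real (x $ i) * of_real (x $ j) * pderivative i (pderivative j v) x) +
    (of_real (x $ j) ^ 2 * pderivative i (pderivative i v) x - of_real (x $ j) * pderivative j v x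
      - of_real (x $ j) * of_real (x $ i) * pderivative j (pderivative i v) x)"
  using assms
  by (simp add: numeral_2_eq_2 K_op_def[abs_def] pderivative_diff differentiable_component_scaleR
      pderivative_component_scaleR)
    (simp add: scaleR_conv_of_real algebra_simps)

lemma A_op_squared:
  assumes "\<And>k. pderivative k v differentiable (at x)" "i \<noteq> j"
  shows "(A_op i j ^^ 2) v x =
    (of_real (x $ i) * pderivative i v x + of_real (x $ i) ^ 2 * pderivative i (pderivative i v) x
      - of_real (x $ i) * of_real (x $ j) * pderivative i (pderivative j v) x) +
    (of_real (x $ j) * pderivative j v x + of_real (x $ j) ^ 2 * pderivative j (pderivative j v) x
      - of_real (x $ j) * of_real (x $ i) * pderivative j (pderivative i v) x)"
  using assms
  by (simp add: numeral_2_eq_2 A_op_def[abs_def] pderivative_diff differentiable_component_scaleR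
      pderivative_component_scaleR)
    (simp add: scaleR_conv_of_real algebra_simps)

text \<open>Both sides are the derivative at r = 1 of v(rx): the left one by the chain rule, the
  right one by homogeneity.\<close>

lemma euler_identity:
  fixes v :: "real ^ 'n \<Rightarrow> complex"
  assumes "v \<in> V l" "x \<noteq> 0"
  shows "(\<Sum>i\<in>UNIV. x $ i *\<^sub>R pderivative i v x) = l * v x"
proof -
  let ?D = "frechet_derivative v (at x)"
  have "v differentiable (at x)"
    using assms by (auto simp: V_def intro: smooth_on_differentiable)
  then have D: "(v has_derivative ?D) (at x)"
    by (simp add: frechet_derivative_works)
  then have lin: "linear ?D"
    by (rule has_derivative_linear)
  have "((\<lambda>r::real. r *\<^sub>R x) has_vector_derivative x) (at 1)"
    by (auto intro!: derivative_eq_intros)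
  then have "((v \<circ> (\<lambda>r. r *\<^sub>R x)) has_vector_derivative ?D x) (at 1)"
    using D by (intro vector_derivative_diff_chain_within)
      (auto intro: has_derivative_at_withinI)
  \<comment> \<open>The exponent is complex, so the power is differentiated as a holomorphic
    function near 1 and then restricted to the real line.\<close>
  moreover have "((\<lambda>r. of_real r powr l * v x) has_vector_derivative l * v x) (at 1)"
    by (intro has_vector_derivative_real_field[of "\<lambda>z. z powr l * v x"])
      (auto intro!: derivative_eq_intros)
  \<comment> \<open>Homogeneity is used only for r > 0, an open neighbourhood of 1 on which |r| =
    r.\<close>
  then have "((v \<circ> (\<lambda>r. r *\<^sub>R x)) has_vector_derivative l * v x) (at 1)"
    by (rule has_vector_derivative_transform_within_open[where S = "{0<..}"])
      (use assms in \<open>auto simp: V_def\<close>)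
  ultimately have "?D x = l * v x"
    by (rule vector_derivative_unique_at)
  moreover have "?D x = ?D (\<Sum>i\<in>UNIV. x $ i *\<^sub>R axis i 1)"
    using basis_expansion[of x] by (simp add: scalar_mult_eq_scaleR)
  ultimately show ?thesis
    using lin by (simp add: linear_sum linear_scale pderivative_def)
qed

text \<open>Apply the i-th partial derivative to Euler's identity, multiply by x_i and sum over i.
  The product rule contributes one extra first-order term, from j = i; these add up to
  \<open>l * v x\<close> by Euler's identity again.\<close>

lemma euler_identity_squared:
  fixes v :: "real ^ 'n \<Rightarrow> complex"
  assumes "v \<in> V l" "x \<noteq> 0"
  shows "(\<Sum>i\<in>UNIV. \<Sum>j\<in>UNIV. of_real (x $ i) * of_real (x $ j) * pderivative i (pderivative j v) x)
         + l * v x = l\<^sup>2 * v x"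
proof -
  have smooth: "smooth_on (- {0}) v"
    using assms by (simp add: V_def)
  have dv: "v differentiable (at x)"
    using smooth assms(2) by (auto intro: smooth_on_differentiable)
  have dp: "pderivative k v differentiable (at x)" for k
    using smooth_on_pderivative[OF smooth] assms(2) by (auto intro: smooth_on_differentiable)
  have "(\<Sum>j\<in>UNIV. x $ j *\<^sub>R pderivative i (pderivative j v) x) + pderivative i v x
        = l * pderivative i v x" for i
  proof -
    have "(\<Sum>j\<in>UNIV. x $ j *\<^sub>R pderivative i (pderivative j v) x) + pderivative i v x
        = pderivative i (\<lambda>y. \<Sum>j\<in>UNIV. y $ j *\<^sub>R pderivative j v y) x"
      using dp by (simp add: pderivative_sum differentiable_component_scaleR
          pderivative_component_scaleR sum.distrib)
    also have "\<dots> = pderivative i (\<lambda>y. l * v y) x"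
      using assms dp
      by (intro pderivative_cong_open[of "- {0}"])
        (auto intro!: differentiable_sum differentiable_component_scaleR euler_identity)
    also have "\<dots> = l * pderivative i v x"
      by (rule pderivative_cmult[OF dv])
    finally show ?thesis .
  qed
  then have "(\<Sum>i\<in>UNIV. x $ i *\<^sub>R ((\<Sum>j\<in>UNIV. x $ j *\<^sub>R pderivative i (pderivative j v) x)
        + pderivative i v x)) = l * (\<Sum>i\<in>UNIV. x $ i *\<^sub>R pderivative i v x)"
    by (simp add: sum_distrib_left)
  then show ?thesis
    unfolding scaleR_add_right sum.distrib euler_identity[OF assms]
    by (simp add: sum_distrib_left scaleR_conv_of_real power2_eq_square mult.assoc)
qed

text \<open>Exchanging the indices turns the second summand into the sum over j < i. Sums over
  unordered pairs thus become comparable with the sum of the squares of the \<open>N_op i j\<close>,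
  which runs over ordered pairs.\<close>

lemma sum_less_symmetrized:
  fixes g :: "'n::{finite,linorder} \<Rightarrow> 'n \<Rightarrow> 'a::comm_monoid_add"
  shows "(\<Sum>(i, j)\<in>{(i, j). i < j}. g i j + g j i) = (\<Sum>(i, j)\<in>{(i, j). i \<noteq> j}. g i j)"
proof -
  have "(\<Sum>(i, j)\<in>{(i, j). i < j}. g j i) = (\<Sum>(i, j)\<in>{(i, j). j < i}. g i j)"
    by (rule sum.reindex_bij_witness[where i = prod.swap and j = prod.swap]) auto
  moreover have "{(i, j). i \<noteq> j} = {(i, j). i < j} \<union> {(i, j). j < (i :: 'n)}"
    by auto
  moreover have "(\<Sum>(i, j)\<in>{(i, j). i < j} \<union> {(i, j). j < i}. g i j)
      = (\<Sum>(i, j)\<in>{(i, j). i < j}. g i j) + (\<Sum>(i, j)\<in>{(i, j). j < i}. g i j)"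
    by (rule sum.union_disjoint) auto
  ultimately show ?thesis
    by (simp add: split_def sum.distrib)
qed

lemma sum_off_diagonal:
  fixes g :: "'n::finite \<Rightarrow> 'n \<Rightarrow> 'a::ab_group_add"
  shows "(\<Sum>(i, j)\<in>{(i, j). i \<noteq> j}. g i j) = (\<Sum>i\<in>UNIV. \<Sum>j\<in>UNIV. g i j) - (\<Sum>i\<in>UNIV. g i i)"
proof -
  have "(\<Sum>(i, j)\<in>{(i, j). i \<noteq> j}. g i j) = (\<Sum>(i, j)\<in>(SIGMA i:UNIV. UNIV - {i}). g i j)"
    by (rule sum.cong) auto
  also have "\<dots> = (\<Sum>i\<in>UNIV. \<Sum>j\<in>UNIV - {i}. g i j)"
    by (rule sum.Sigma[symmetric]) auto
  also have "\<dots> = (\<Sum>i\<in>UNIV. (\<Sum>j\<in>UNIV. g i j) - g i i)"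
    by (simp add: sum_diff1)
  finally show ?thesis
    by (simp add: sum_subtractf)
qed

theorem proposition1p1:
  fixes l :: complex and d :: nat
    and v :: "real ^ 'n::{finite,linorder} \<Rightarrow> complex" and x :: "real ^ 'n::{finite,linorder}"
  assumes "d = CARD('n)" and "d \<ge> 2"
    and "v \<in> V l" and "x \<noteq> 0"
  shows "(\<Sum>(i, j)\<in>{(i, j). i \<noteq> j}. (N_op i j ^^ 2) v x) =
         Delta_K v x + (of_nat d - 1) * l * v x + (of_nat d - 1) / of_nat d * l\<^sup>2 * v x
         - 1 / of_nat d * (\<Sum>(i, j)\<in>{(i, j). i < j}. (A_op i j ^^ 2) v x)"
proof -
  define X where "X i = complex_of_real (x $ i)" for i
  define p where "p i = pderivative i v x" for i
  define D where "D i j = pderivative i (pderivative j v) x" for i j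
  \<comment> \<open>\<open>S\<close> and \<open>M\<close> are the pure and the mixed second-order
    sums over ordered pairs. \<open>Q\<close> is the value of \<Sum> e_i^2 - E on \<open>v\<close>
    at \<open>x\<close>, in the notation of the overview.\<close>
  define S where "S = (\<Sum>(i, j)\<in>{(i, j). i \<noteq> j}. X i ^ 2 * D j j)"
  define M where "M = (\<Sum>(i, j)\<in>{(i, j). i \<noteq> j}. X i * X j * D i j)"
  define Q where "Q = (\<Sum>i\<in>UNIV. X i ^ 2 * D i i)"
  have dp: "pderivative k v differentiable (at x)" for k
    using assms(3,4) smooth_on_pderivative[of "- {0}" v k]
    by (auto simp: V_def intro: smooth_on_differentiable)
  have E: "(\<Sum>i\<in>UNIV. X i * p i) = l * v x"
    using euler_identity[OF assms(3,4)] by (simp add: X_def p_def scaleR_conv_of_real)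
  \<comment> \<open>Each \<open>i\<close> is the first index of exactly d - 1 ordered pairs.\<close>
  have const: "(\<Sum>(i, j)\<in>{(i, j). i \<noteq> j}. f i) = (of_nat d - 1) * (\<Sum>i\<in>UNIV. f i)"
    for f :: "'n \<Rightarrow> complex"
    by (simp add: sum_off_diagonal assms(1) sum_distrib_left[symmetric] left_diff_distrib)
  \<comment> \<open>The full double sum of the second-order Euler identity splits into
    \<open>M\<close> off the diagonal and \<open>Q\<close> on it.\<close>
  have "M = (\<Sum>i\<in>UNIV. \<Sum>j\<in>UNIV. X i * X j * D i j) - Q"
    by (simp add: M_def Q_def sum_off_diagonal power2_eq_square)
  then have E2: "M + Q + l * v x = l\<^sup>2 * v x"
    using euler_identity_squared[OF assms(3,4)] by (simp add: X_def D_def)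
  have N: "(\<Sum>(i, j)\<in>{(i, j). i \<noteq> j}. (N_op i j ^^ 2) v x) = S"
    unfolding S_def by (rule sum.cong) (auto simp: N_op_squared dp X_def D_def)
  have "Delta_K v x = (\<Sum>(i, j)\<in>{(i, j). i < j}.
      (X i ^ 2 * D j j - X i * p i - X i * X j * D i j)
      + (X j ^ 2 * D i i - X j * p j - X j * X i * D j i))"
    unfolding Delta_K_def by (rule sum.cong) (auto simp: K_op_squared dp X_def D_def p_def)
  also have "\<dots> = (\<Sum>(i, j)\<in>{(i, j). i \<noteq> j}. X i ^ 2 * D j j - X i * p i - X i * X j * D i j)"
    by (rule sum_less_symmetrized)
  also have "\<dots> = S - (\<Sum>(i, j)\<in>{(i, j::'n). i \<noteq> j}. X i * p i) - M"
    by (simp add: S_def M_def split_def sum_subtractf)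
  finally have K: "Delta_K v x = S - (of_nat d - 1) * (l * v x) - M"
    by (simp only: const E)
  have "(\<Sum>(i, j)\<in>{(i, j). i < j}. (A_op i j ^^ 2) v x) = (\<Sum>(i, j)\<in>{(i, j). i < j}.
      (X i * p i + X i ^ 2 * D i i - X i * X j * D i j)
      + (X j * p j + X j ^ 2 * D j j - X j * X i * D j i))"
    by (rule sum.cong) (auto simp: A_op_squared dp X_def D_def p_def)
  also have "\<dots> = (\<Sum>(i, j)\<in>{(i, j). i \<noteq> j}. X i * p i + X i ^ 2 * D i i - X i * X j * D i j)"
    by (rule sum_less_symmetrized)
  also have "\<dots> = (\<Sum>(i, j)\<in>{(i, j::'n). i \<noteq> j}. X i * p i)
      + (\<Sum>(i, j)\<in>{(i, j::'n). i \<noteq> j}. X i ^ 2 * D i i) - M"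
    by (simp add: M_def split_def sum_subtractf sum.distrib)
  finally have A: "(\<Sum>(i, j)\<in>{(i, j). i < j}. (A_op i j ^^ 2) v x)
      = (of_nat d - 1) * (l * v x) + (of_nat d - 1) * Q - M"
    by (simp only: const E Q_def)
  have "(of_nat d :: complex) \<noteq> 0"
    using assms(2) by simp
  then show ?thesis
    \<comment> \<open>Once \<open>l\<^sup>2 * v x\<close> is replaced by M + Q + l v, the terms in
      \<open>Q\<close> and \<open>l * v x\<close> cancel, and the coefficients of \<open>M\<close>
      add up to -1 + (d - 1)/d + 1/d = 0, which leaves \<open>S\<close>.\<close>
    unfolding N K A mult.assoc E2[symmetric] by (simp add: field_simps)
qed

end
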